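(* If a dynamical system encoder (as defined in the context) is reliable, then it is invertible, i.e. for every $n\ge1$, $\tilde W_1$ is $\overline{\mathbb P}$-a.s. $\sigma(\tilde W_{n+1},Y_{1:n})$-measurable.
   Context: $\mathsf W\subset\mathbb R^d$ and $\mathsf Y$ are (subsets of) Euclidean spaces with Borel $\sigma$-algebras; $\mathsf W$ is open, bounded and convex; $\bar\nu=P_W$ is the uniform distribution on $\mathsf W$. A dynamical system encoder is a collection of maps $S_y:\mathsf W\to\mathsf W$, $y\in\mathsf Y$ (with $(y,w)\mapsto S_y(w)$ measurable) together with a memoryless time-invariant channel given by a transition kernel $P_{Y|\tilde W}$ from $\mathsf W$ to $\mathsf Y$. It generates $(\tilde W_n,Y_n)_{n\ge1}$ by $\tilde W_1=W$, $\tilde W_{n+1}=S_{Y_n}(\tilde W_n)$ for $n\ge1$, where the conditional law of $Y_n$ given $\sigma(\tilde W_{1:n},Y_{1:n-1})$ is $P_{Y|\tilde W}(\cdot|\tilde W_n)$. $\overline{\mathbb P}$ is the law of this process when $W\sim\bar\nu$. "A random variable $U$ is $\overline{\mathbb P}$-a.s. $\mathcal G$-measurable" means $U$ equals $\overline{\mathbb P}$-a.s. a $\mathcal G$-measurable random variable. Reliable means: $W$ is $\overline{\mathbb P}$-a.s. $\sigma(Y_1,Y_2,\dots)$-measurable. *)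

theory Defs
  imports "HOL-Probability.Probability"
begin

locale dynamical_system_encoder =
  fixes W :: "'a::euclidean_space set"
    and Y :: "'b::euclidean_space set"
    and S :: "'b \<Rightarrow> 'a \<Rightarrow> 'a"
    and P :: "'a \<Rightarrow> 'b measure"
  assumes open_W: "open W"
    and bounded_W: "bounded W"
    and convex_W: "convex W"
    and measurable_S: "(\<lambda>(y, w). S y w) \<in>
      restrict_space borel Y \<Otimes>\<^sub>M restrict_space borel W \<rightarrow>\<^sub>M restrict_space borel W"
    and kernel_P: "P \<in> restrict_space borel W \<rightarrow>\<^sub>M prob_algebra (restrict_space borel Y)"

(* The sigma-algebra \<sigma>(U i, V j : i \<in> I, j \<in> J) on the sample space of M, as a measure
   space; only its space and its sets are relevant. *)
definition generated_algebra ::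
  "'w measure \<Rightarrow> 'a measure \<Rightarrow> 'b measure \<Rightarrow> (nat \<Rightarrow> 'w \<Rightarrow> 'a) \<Rightarrow> (nat \<Rightarrow> 'w \<Rightarrow> 'b) \<Rightarrow>
    nat set \<Rightarrow> nat set \<Rightarrow> 'w measure" where
  "generated_algebra M A B U V I J =
     sigma (space M)
       ((\<Union>i\<in>I. sets (vimage_algebra (space M) (U i) A)) \<union>
        (\<Union>j\<in>J. sets (vimage_algebra (space M) (V j) B)))"

(* A realisation, on an arbitrary probability space M, of the process started from the uniform
   distribution on W. Indices start at 1; the values at index 0 are unconstrained. The recursion
   is required almost surely, so that the coordinate process under its law on path space is
   included. *)
locale encoder_process = dynamical_system_encoder W Y S P + prob_space M
  for W :: "'a::euclidean_space set"
    and Y :: "'b::euclidean_space set"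
    and S :: "'b \<Rightarrow> 'a \<Rightarrow> 'a"
    and P :: "'a \<Rightarrow> 'b measure"
    and M :: "'w measure" +
  fixes Wt :: "nat \<Rightarrow> 'w \<Rightarrow> 'a"
    and Yt :: "nat \<Rightarrow> 'w \<Rightarrow> 'b"
  assumes measurable_Wt: "\<And>n. n \<ge> 1 \<Longrightarrow> Wt n \<in> M \<rightarrow>\<^sub>M restrict_space borel W"
    and measurable_Yt: "\<And>n. n \<ge> 1 \<Longrightarrow> Yt n \<in> M \<rightarrow>\<^sub>M restrict_space borel Y"
    and initial: "distr M lborel (Wt 1) = uniform_measure lborel W"
    and dynamics: "\<And>n. n \<ge> 1 \<Longrightarrow> AE \<omega> in M. Wt (n + 1) \<omega> = S (Yt n \<omega>) (Wt n \<omega>)"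
    and channel: "\<And>n B. n \<ge> 1 \<Longrightarrow> B \<in> sets (restrict_space borel Y) \<Longrightarrow>
      AE \<omega> in M.
        real_cond_exp M
          (generated_algebra M (restrict_space borel W) (restrict_space borel Y) Wt Yt {1..n} {1..<n})
          (indicator (Yt n -` B \<inter> space M)) \<omega>
        = measure (P (Wt n \<omega>)) B"

definition as_measurable ::
  "'w measure \<Rightarrow> 'w measure \<Rightarrow> 'a measure \<Rightarrow> ('w \<Rightarrow> 'a) \<Rightarrow> bool" where
  "as_measurable M G N U \<longleftrightarrow> (\<exists>V \<in> G \<rightarrow>\<^sub>M N. AE \<omega> in M. U \<omega> = V \<omega>)"

definition reliable_encoder ::
  "'a::euclidean_space set \<Rightarrow> 'b::euclidean_space set \<Rightarrow> 'w measure \<Rightarrow>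
    (nat \<Rightarrow> 'w \<Rightarrow> 'a) \<Rightarrow> (nat \<Rightarrow> 'w \<Rightarrow> 'b) \<Rightarrow> bool" where
  "reliable_encoder W Y M Wt Yt \<longleftrightarrow>
     as_measurable M
       (generated_algebra M (restrict_space borel W) (restrict_space borel Y) Wt Yt {} {1..})
       (restrict_space borel W) (Wt 1)"

definition invertible_encoder ::
  "'a::euclidean_space set \<Rightarrow> 'b::euclidean_space set \<Rightarrow> 'w measure \<Rightarrow>
    (nat \<Rightarrow> 'w \<Rightarrow> 'a) \<Rightarrow> (nat \<Rightarrow> 'w \<Rightarrow> 'b) \<Rightarrow> bool" where
  "invertible_encoder W Y M Wt Yt \<longleftrightarrow>
     (\<forall>n\<ge>1. as_measurable M
       (generated_algebra M (restrict_space borel W) (restrict_space borel Y) Wt Yt {n + 1} {1..n})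
       (restrict_space borel W) (Wt 1))"

end

theory Submission imports Defs begin

text \<open>
  Let \<open>F = \<sigma>(W\<^sub>1, \<dots>, W\<^sub>n\<^sub>+\<^sub>1, Y\<^sub>1, \<dots>, Y\<^sub>n)\<close> and \<open>K = \<sigma>(W\<^sub>n\<^sub>+\<^sub>1, Y\<^sub>1, \<dots>, Y\<^sub>n)\<close>, where \<open>W\<^sub>i\<close> denotes the
  state at time \<open>i\<close>. By the Markov property, the outputs after time \<open>n\<close> are conditionally independent
  of \<open>F\<close> given \<open>W\<^sub>n\<^sub>+\<^sub>1\<close>; hence \<open>E[X | F] = E[X | K]\<close> for every integrable function \<open>X\<close> of the whole
  output sequence. Reliability makes each coordinate of \<open>W\<^sub>1\<close> almost surely equal to such an \<open>X\<close>, and \<open>W\<^sub>1\<close> is also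
  \<open>F\<close>-measurable, so \<open>X = E[X | F] = E[X | K]\<close> is almost surely \<open>K\<close>-measurable.
\<close>

section \<open>Conditional independence of sigma-algebras through conditional expectations\<close>

lemma subalgebra_trans: "subalgebra M F \<Longrightarrow> subalgebra F G \<Longrightarrow> subalgebra M G"
  by (auto simp: subalgebra_def)

context prob_space
begin

text \<open>Since \<open>G\<close> is contained in \<open>F\<close>, this says that \<open>E\<close> and \<open>F\<close> are conditionally independent
  given \<open>G\<close>.\<close>

definition cond_indep :: "'a measure \<Rightarrow> 'a measure \<Rightarrow> 'a measure \<Rightarrow> bool" where
  "cond_indep E F G \<longleftrightarrow> subalgebra M E \<and> subalgebra M F \<and> subalgebra F G \<and>
     (\<forall>X\<in>borel_measurable E. integrable M X \<longrightarrow>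
        (AE x in M. real_cond_exp M F X x = real_cond_exp M G X x))"

lemma sigma_finite_subalgebraI: "subalgebra M F \<Longrightarrow> sigma_finite_subalgebra M F"
  by (simp add: finite_measure_axioms finite_measure_subalgebra.intro
      finite_measure_subalgebra_axioms.intro finite_measure_subalgebra_is_sigma_finite)

lemma integrable_indicatorI: "A \<in> events \<Longrightarrow> integrable M (indicator A :: 'a \<Rightarrow> real)"
  by (rule integrable_real_indicator) (auto simp: less_top[symmetric])

text \<open>Tower property: conditioning E[X | F] further on \<open>G\<close> gives E[X | G], and
  \<open>Z\<close>, being \<open>G\<close>-measurable, is left unchanged. This turns "the
  conditional expectation given \<open>F\<close> depends only on \<open>G\<close>" into an equality
  of conditional expectations.\<close>

lemma real_cond_exp_eqI:
  assumes F: "subalgebra M F" and FG: "subalgebra F G"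
    and X: "integrable M X" and Z: "Z \<in> borel_measurable G"
    and eq: "AE x in M. real_cond_exp M F X x = Z x"
  shows "AE x in M. real_cond_exp M G X x = Z x"
proof -
  interpret F: sigma_finite_subalgebra M F by (rule sigma_finite_subalgebraI[OF F])
  have G: "subalgebra M G" using F FG by (rule subalgebra_trans)
  interpret G: sigma_finite_subalgebra M G by (rule sigma_finite_subalgebraI[OF G])
  have Z': "Z \<in> borel_measurable M" by (rule measurable_from_subalg[OF G Z])
  have int: "integrable M Z"
    using integrable_cong_AE[OF _ Z' eq] F.real_cond_exp_int(1)[OF X] by simp
  show ?thesis
    using G.real_cond_exp_nested_subalg[OF F FG X]
      G.real_cond_exp_cong[OF eq _ Z'] G.real_cond_exp_F_meas[OF int Z]
    by auto
qed

text \<open>Pi-lambda argument: since the whole space lies in \<open>R\<close>, complements inherit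
  the vanishing integral, and countable disjoint unions inherit it by countable additivity.\<close>

lemma set_integral_eq_0_generator:
  fixes f :: "'a \<Rightarrow> real"
  assumes f: "integrable M f" and stable: "Int_stable R" and R: "R \<subseteq> sets M"
    and space: "space M \<in> R"
    and zero: "\<And>A. A \<in> R \<Longrightarrow> (LINT x:A|M. f x) = 0"
    and A: "A \<in> sigma_sets (space M) R"
  shows "(LINT x:A|M. f x) = 0"
proof -
  have sub: "sigma_sets (space M) R \<subseteq> sets M"
    using R by (rule sets.sigma_sets_subset)
  have si: "set_integrable M A f" if "A \<in> sets M" for A
    unfolding set_integrable_def using integrable_mult_indicator[OF that f] .
  have "R \<subseteq> Pow (space M)" using R sets.sets_into_space by auto
  from stable this A show ?thesis
  proof (induction rule: sigma_sets_induct_disjoint)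
    case (basic A) then show ?case by (rule zero)
  next
    case empty then show ?case by (simp add: set_lebesgue_integral_def)
  next
    case (compl A)
    then have A: "A \<in> sets M" using sub by auto
    have "(LINT x:space M|M. f x) = (LINT x:A \<union> (space M - A)|M. f x)"
      using sets.sets_into_space[OF A] by (simp add: Un_absorb1)
    also have "\<dots> = (LINT x:A|M. f x) + (LINT x:(space M - A)|M. f x)"
      by (rule set_integral_Un) (auto intro!: si A)
    finally show ?case using zero[OF space] compl by simp
  next
    case (union A)
    have A: "A i \<in> events" for i using union(2) sub by blast
    have "(LINT x:(\<Union>i. A i)|M. f x) = (\<Sum>i. (LINT x:(A i)|M. f x))"
      using union(1) A by (intro lebesgue_integral_countable_add si sets.countable_UN)
        (auto simp: disjoint_family_on_def)
    then show ?case using union by simp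
  qed
qed

text \<open>Tested on \<open>B \<in> F\<close>, the claim for \<open>X\<close> reads \<open>E[X f] = 0\<close> with \<open>f = 1\<^sub>B - P(B | G)\<close>. For indicators
  \<open>X\<close> this passes from the generator to \<open>E\<close>, so that \<open>E[f | E] = 0\<close>; no approximation of \<open>X\<close> by
  simple functions is needed.\<close>

lemma cond_indepI:
  assumes E: "subalgebra M E" and F: "subalgebra M F" and FG: "subalgebra F G"
    and stable: "Int_stable R" and space: "space M \<in> R"
    and sets_E: "sets E = sigma_sets (space M) R"
    and ind: "\<And>A. A \<in> R \<Longrightarrow>
      AE x in M. real_cond_exp M F (indicator A) x = real_cond_exp M G (indicator A) x"
  shows "cond_indep E F G"
  unfolding cond_indep_def
proof (intro conjI ballI impI E F FG)
  fix X :: "'a \<Rightarrow> real"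
  assume X[measurable]: "X \<in> borel_measurable E" and int: "integrable M X"
  have G: "subalgebra M G" using F FG by (rule subalgebra_trans)
  interpret E: sigma_finite_subalgebra M E by (rule sigma_finite_subalgebraI[OF E])
  interpret F: sigma_finite_subalgebra M F by (rule sigma_finite_subalgebraI[OF F])
  interpret G: sigma_finite_subalgebra M G by (rule sigma_finite_subalgebraI[OF G])
  have R: "R \<subseteq> sets M" using sets_E E unfolding subalgebra_def by auto
  have [measurable]: "X \<in> borel_measurable M" using int by simp
  have G_F: "h \<in> borel_measurable F" if "h \<in> borel_measurable G" for h :: "'a \<Rightarrow> real"
    using measurable_from_subalg[OF FG that] .
  show "AE x in M. real_cond_exp M F X x = real_cond_exp M G X x"
  proof (rule F.real_cond_exp_charact)
    fix B assume B: "B \<in> sets F"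
    then have BM[measurable]: "B \<in> sets M" using F by (auto simp: subalgebra_def)
    \<comment> \<open>\<open>c\<close> is P(B | G). It lies in [0, 1] almost surely, so
      multiplication by it preserves integrability even when \<open>X\<close> is unbounded.\<close>
    define c where "c = real_cond_exp M G (indicator B)"
    have c[measurable]: "c \<in> borel_measurable G" "c \<in> borel_measurable M"
      by (simp_all add: c_def)
    have iB: "integrable M (indicator B :: 'a \<Rightarrow> real)" by (rule integrable_indicatorI[OF BM])
    have ic: "integrable M c" unfolding c_def by (rule G.real_cond_exp_int(1)[OF iB])
    have c_bound: "AE x in M. norm (c x) \<le> 1"
    proof -
      have "AE x in M. c x \<ge> 0" "AE x in M. c x \<le> 1"
        unfolding c_def using iB by (auto intro!: G.real_cond_exp_ge_c G.real_cond_exp_le_c)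
      then show ?thesis by auto
    qed
    have Xc: "integrable M (\<lambda>x. c x * h x)" if "integrable M h" for h
      by (rule Bochner_Integration.integrable_bound[OF that])
        (use c_bound that in \<open>auto simp: abs_mult intro!: mult_left_le_one_le\<close>)
    have XB: "integrable M (\<lambda>x. indicator B x * h x)" if "integrable M h" for h :: "'a \<Rightarrow> real"
      using integrable_mult_indicator[OF BM that] by simp
    define f where "f = (\<lambda>x. indicator B x - c x)"
    have f: "integrable M f" unfolding f_def using iB ic by simp
    \<comment> \<open>Conditional expectation is self-adjoint: E[1_B 1_A] = E[1_B P(A | F)] =
      E[1_B P(A | G)] = E[P(A | G) c] = E[c 1_A].\<close>
    have "(LINT x:A|M. f x) = 0" if "A \<in> R" for A
    proof -
      have A[measurable]: "A \<in> sets M" using that R by auto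
      have iA: "integrable M (indicator A :: 'a \<Rightarrow> real)" by (rule integrable_indicatorI[OF A])
      have "(\<integral>x. indicator B x * indicator A x \<partial>M) =
          (\<integral>x. indicator B x * real_cond_exp M F (indicator A) x \<partial>M)"
        using F.real_cond_exp_intg(2)[OF XB[OF iA]] B by simp
      also have "\<dots> = (\<integral>x. indicator B x * real_cond_exp M G (indicator A) x \<partial>M)"
        using ind[OF that] by (intro integral_cong_AE) auto
      also have "\<dots> = (\<integral>x. real_cond_exp M G (indicator A) x * indicator B x \<partial>M)"
        by (simp add: mult.commute)
      also have "\<dots> = (\<integral>x. real_cond_exp M G (indicator A) x * c x \<partial>M)"
        unfolding c_def
        by (rule G.real_cond_exp_intg(2)[symmetric])
          (use XB[OF G.real_cond_exp_int(1)[OF iA]] in \<open>auto simp: mult.commute\<close>)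
      also have "\<dots> = (\<integral>x. c x * indicator A x \<partial>M)"
        using G.real_cond_exp_intg(2)[OF Xc[OF iA]] by (simp add: mult.commute)
      finally have "(\<integral>x. indicator B x * indicator A x - c x * indicator A x \<partial>M) = 0"
        using XB[OF iA] Xc[OF iA] by simp
      then show ?thesis
        by (simp add: f_def set_lebesgue_integral_def algebra_simps)
    qed
    then have "(LINT x:A|M. f x) = 0" if "A \<in> sets E" for A
      using set_integral_eq_0_generator[OF f stable R space] that sets_E by blast
    then have f0: "AE x in M. real_cond_exp M E f x = 0"
      by (intro E.real_cond_exp_charact f) auto
    have Xf: "integrable M (\<lambda>x. X x * f x)"
      using XB[OF int] Xc[OF int] by (simp add: f_def algebra_simps)
    \<comment> \<open>As \<open>X\<close> is \<open>E\<close>-measurable, \<open>f\<close> may be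
      replaced by E[f | E] = 0. Self-adjointness then moves the projection onto \<open>G\<close>
      from \<open>indicator B\<close> over to \<open>X\<close>.\<close>
    have "(\<integral>x. X x * f x \<partial>M) = (\<integral>x. X x * real_cond_exp M E f x \<partial>M)"
      using E.real_cond_exp_intg(2)[OF Xf X] f by simp
    also have "\<dots> = (\<integral>x. 0 \<partial>M)" using f0 by (intro integral_cong_AE) auto
    finally have "(\<integral>x. indicator B x * X x \<partial>M) = (\<integral>x. c x * X x \<partial>M)"
      using XB[OF int] Xc[OF int] by (simp add: f_def algebra_simps)
    also have "\<dots> = (\<integral>x. c x * real_cond_exp M G X x \<partial>M)"
      using G.real_cond_exp_intg(2)[OF Xc[OF int]] by simp
    also have "\<dots> = (\<integral>x. real_cond_exp M G X x * indicator B x \<partial>M)"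
      unfolding c_def
      by (subst mult.commute, rule G.real_cond_exp_intg(2))
        (use XB[OF G.real_cond_exp_int(1)[OF int]] in \<open>auto simp: mult.commute\<close>)
    finally show "(LINT x:B|M. X x) = (LINT x:B|M. real_cond_exp M G X x)"
      by (simp add: set_lebesgue_integral_def mult.commute)
  qed (auto intro: int G.real_cond_exp_int(1) G_F)
qed

lemma cond_indepD:
  assumes "cond_indep E F G"
  shows "subalgebra M E" "subalgebra M F" "subalgebra F G" "subalgebra M G"
    "\<And>X. X \<in> borel_measurable E \<Longrightarrow> integrable M X \<Longrightarrow>
      AE x in M. real_cond_exp M F X x = real_cond_exp M G X x"
  using assms subalgebra_trans[of M F G] unfolding cond_indep_def by auto

lemma cond_indep_mono:
  assumes "cond_indep E F G" "subalgebra E E'"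
  shows "cond_indep E' F G"
  using assms subalgebra_trans[of M E E'] measurable_from_subalg[of E E' _ borel]
  unfolding cond_indep_def by blast

text \<open>E[X | F] already has a \<open>G\<close>-measurable version, which is also
  \<open>K\<close>-measurable; the tower property identifies it with E[X | K].\<close>

lemma cond_indep_enlarge:
  assumes EFG: "cond_indep E F G" and FK: "subalgebra F K" and KG: "subalgebra K G"
  shows "cond_indep E F K"
  unfolding cond_indep_def
proof (intro conjI ballI impI FK cond_indepD(1,2)[OF EFG])
  fix X :: "'a \<Rightarrow> real"
  assume X: "X \<in> borel_measurable E" "integrable M X"
  show "AE x in M. real_cond_exp M F X x = real_cond_exp M K X x"
    using cond_indepD(5)[OF EFG X] real_cond_exp_eqI[OF cond_indepD(2)[OF EFG] FK X(2)
      measurable_from_subalg[OF KG borel_measurable_cond_exp] cond_indepD(5)[OF EFG X]]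
    by auto
qed

text \<open>The intersections of a set \<open>A\<close> of \<open>E\<close> with a set
  \<open>C\<close> of \<open>G\<close> are a stable generator of the join. For them the factor
  \<open>indicator C\<close> comes out of both conditional expectations, because \<open>C\<close>
  belongs to \<open>G\<close> and hence to \<open>F\<close>.\<close>

lemma cond_indep_join:
  assumes EFG: "cond_indep E F G"
  shows "cond_indep (sigma (space M) (sets E \<union> sets G)) F G"
proof -
  note sub = cond_indepD(1-4)[OF EFG]
  have E: "sets E \<subseteq> sets M" "space E = space M" and G: "sets G \<subseteq> sets M" "space G = space M"
    using sub by (auto simp: subalgebra_def)
  have sets_M: "sets E \<union> sets G \<subseteq> sets M" using E G by auto
  then have Pow: "sets E \<union> sets G \<subseteq> Pow (space M)" using sets.space_closed by blast
  interpret F: sigma_finite_subalgebra M F by (rule sigma_finite_subalgebraI[OF sub(2)])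
  interpret G: sigma_finite_subalgebra M G by (rule sigma_finite_subalgebraI[OF sub(4)])
  define R where "R = {A \<inter> C | A C. A \<in> sets E \<and> C \<in> sets G}"
  have RI: "A \<inter> C \<in> R" if "A \<in> sets E" "C \<in> sets G" for A C
    using that by (auto simp: R_def)
  show ?thesis
  proof (rule cond_indepI[where R = R])
    show "subalgebra M (sigma (space M) (sets E \<union> sets G))"
      using sets.sigma_sets_subset[OF sets_M] Pow by (simp add: subalgebra_def)
    show "Int_stable R"
    proof (rule Int_stableI)
      fix a b assume "a \<in> R" "b \<in> R"
      then obtain A C A' C' where "a = A \<inter> C" "b = A' \<inter> C'" "A \<in> sets E" "A' \<in> sets E"
        "C \<in> sets G" "C' \<in> sets G" by (auto simp: R_def)
      then show "a \<inter> b \<in> R" using RI[of "A \<inter> A'" "C \<inter> C'"] by (simp add: Int_ac)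
    qed
    show "space M \<in> R" using RI[OF sets.top sets.top] E G by simp
    have "R \<subseteq> sigma_sets (space M) (sets E \<union> sets G)"
    proof
      fix a assume "a \<in> R"
      then obtain A C where a: "a = A \<inter> C" "A \<in> sets E" "C \<in> sets G"
        by (auto simp: R_def)
      have "A \<inter> C \<in> sets (sigma (space M) (sets E \<union> sets G))"
        using a Pow by (intro sets.Int) auto
      then show "a \<in> sigma_sets (space M) (sets E \<union> sets G)"
        using Pow a by simp
    qed
    moreover have "sets E \<union> sets G \<subseteq> R"
    proof
      fix a assume a: "a \<in> sets E \<union> sets G"
      then have "a \<inter> space M = a" "space M \<inter> a = a" using Pow by auto
      then show "a \<in> R"
        using a RI[of a "space M"] RI[of "space M" a] sets.top[of E] sets.top[of G] E(2) G(2)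
        by auto
    qed
    ultimately have "sigma_sets (space M) (sets E \<union> sets G) = sigma_sets (space M) R"
      by (meson sigma_sets_mono sigma_sets_mono' subset_antisym)
    then show "sets (sigma (space M) (sets E \<union> sets G)) = sigma_sets (space M) R"
      using Pow by simp
    fix a assume "a \<in> R"
    then obtain A C where a: "a = A \<inter> C" and A: "A \<in> sets E" and C: "C \<in> sets G"
      by (auto simp: R_def)
    have [measurable]: "A \<in> sets M" "C \<in> sets M" using A C E G by auto
    have CF: "C \<in> sets F" using C sub(3) by (auto simp: subalgebra_def)
    have a': "indicator a = (\<lambda>x. indicator C x * indicator A x :: real)"
      by (auto simp: a indicator_def)
    have int: "integrable M (\<lambda>x. indicator C x * indicator A x :: real)"
      unfolding a'[symmetric] a by (intro integrable_indicatorI sets.Int) auto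
    have "AE x in M. real_cond_exp M F (indicator a) x = indicator C x * real_cond_exp M F (indicator A) x"
      unfolding a' by (rule F.real_cond_exp_mult) (use CF int in auto)
    moreover have "AE x in M. real_cond_exp M G (indicator a) x = indicator C x * real_cond_exp M G (indicator A) x"
      unfolding a' by (rule G.real_cond_exp_mult) (use C int in auto)
    moreover have "AE x in M. real_cond_exp M F (indicator A) x = real_cond_exp M G (indicator A) x"
      using A by (intro cond_indepD(5)[OF EFG] integrable_indicatorI) auto
    ultimately show "AE x in M. real_cond_exp M F (indicator a) x = real_cond_exp M G (indicator a) x"
      by auto
  qed (use sub in auto)
qed

text \<open>E[X | H] = E[E[X | F] | H] = E[E[X | K] | H] = E[E[X | K] | G] = E[X | G]. The outer
  equalities are tower properties, and the third applies the second hypothesis to the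
  \<open>K\<close>-measurable variable E[X | K].\<close>

lemma cond_indep_trans:
  assumes EFK: "cond_indep E F K" and KHG: "cond_indep K H G"
    and FH: "subalgebra F H" and KG: "subalgebra K G"
  shows "cond_indep E H G"
  unfolding cond_indep_def
proof (intro conjI ballI impI cond_indepD(1)[OF EFK] cond_indepD(2,3)[OF KHG])
  fix X :: "'a \<Rightarrow> real"
  assume X: "X \<in> borel_measurable E" "integrable M X"
  note sub = cond_indepD(1-4)[OF EFK] cond_indepD(1-4)[OF KHG]
  interpret H: sigma_finite_subalgebra M H by (rule sigma_finite_subalgebraI[OF sub(6)])
  interpret G: sigma_finite_subalgebra M G by (rule sigma_finite_subalgebraI[OF sub(8)])
  interpret K: sigma_finite_subalgebra M K by (rule sigma_finite_subalgebraI[OF sub(4)])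
  have "AE x in M. real_cond_exp M H X x = real_cond_exp M H (real_cond_exp M F X) x"
    using H.real_cond_exp_nested_subalg[OF sub(2) FH X(2)] by auto
  moreover have "AE x in M. real_cond_exp M H (real_cond_exp M F X) x = real_cond_exp M H (real_cond_exp M K X) x"
    by (rule H.real_cond_exp_cong[OF cond_indepD(5)[OF EFK X]]) auto
  moreover have "AE x in M. real_cond_exp M H (real_cond_exp M K X) x = real_cond_exp M G (real_cond_exp M K X) x"
    by (rule cond_indepD(5)[OF KHG]) (use K.real_cond_exp_int(1)[OF X(2)] in auto)
  moreover have "AE x in M. real_cond_exp M G (real_cond_exp M K X) x = real_cond_exp M G X x"
    by (rule G.real_cond_exp_nested_subalg[OF sub(4) KG X(2)])
  ultimately show "AE x in M. real_cond_exp M H X x = real_cond_exp M G X x" by auto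
qed

text \<open>The hypothesis \<^term>\<open>cond_indep G M K\<close> says that \<^term>\<open>G\<close> is contained in
  \<^term>\<open>K\<close> up to null sets.\<close>

lemma cond_indep_AE_enlarge:
  assumes EFG: "cond_indep E F G" and GMK: "cond_indep G M K" and FK: "subalgebra F K"
  shows "cond_indep E F K"
  unfolding cond_indep_def
proof (intro conjI ballI impI cond_indepD(1,2)[OF EFG] FK)
  fix X :: "'a \<Rightarrow> real"
  assume X: "X \<in> borel_measurable E" "integrable M X"
  note sub = cond_indepD(1-4)[OF EFG] cond_indepD(1-4)[OF GMK]
  interpret G: sigma_finite_subalgebra M G by (rule sigma_finite_subalgebraI[OF sub(4)])
  interpret MM: sigma_finite_subalgebra M M by (rule sigma_finite_subalgebraI[OF sub(6)])
  define h where "h = real_cond_exp M G X"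
  have h: "h \<in> borel_measurable G" "integrable M h"
    unfolding h_def using G.real_cond_exp_int(1)[OF X(2)] by auto
  \<comment> \<open>Conditioning on \<open>M\<close> itself does nothing, so \<open>GMK\<close>
    gives \<open>h\<close> a \<open>K\<close>-measurable version. That version is then also one of
    E[X | F].\<close>
  have "AE x in M. h x = real_cond_exp M K h x"
    using cond_indepD(5)[OF GMK h]
      MM.real_cond_exp_F_meas[OF h(2) borel_measurable_integrable[OF h(2)]] by auto
  then have eq: "AE x in M. real_cond_exp M F X x = real_cond_exp M K h x"
    using cond_indepD(5)[OF EFG X] by (auto simp: h_def)
  show "AE x in M. real_cond_exp M F X x = real_cond_exp M K X x"
    using eq real_cond_exp_eqI[OF sub(2) FK X(2) borel_measurable_cond_exp eq] by auto
qed

end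

section \<open>Sigma-algebras generated by states and outputs\<close>

lemma space_generated_algebra: "space (generated_algebra M A B U V I J) = space M"
  by (simp add: generated_algebra_def space_measure_of_conv)

lemma sets_vimage_algebra_subset_Pow: "sets (vimage_algebra X f N) \<subseteq> Pow X"
  using sets.space_closed[of "vimage_algebra X f N"] by simp

lemma sets_generated_algebra:
  "sets (generated_algebra M A B U V I J) = sigma_sets (space M)
     ((\<Union>i\<in>I. sets (vimage_algebra (space M) (U i) A)) \<union>
      (\<Union>j\<in>J. sets (vimage_algebra (space M) (V j) B)))"
  unfolding generated_algebra_def
  by (intro sets_measure_of Un_least UN_least sets_vimage_algebra_subset_Pow)

lemma sets_generated_algebra_single_left:
  "sets (generated_algebra M A B U V {i} {}) = sets (vimage_algebra (space M) (U i) A)"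
  using sets.sigma_sets_eq[of "vimage_algebra (space M) (U i) A"]
  by (simp add: sets_generated_algebra)

lemma sets_generated_algebra_single_right:
  "sets (generated_algebra M A B U V {} {j}) = sets (vimage_algebra (space M) (V j) B)"
  using sets.sigma_sets_eq[of "vimage_algebra (space M) (V j) B"]
  by (simp add: sets_generated_algebra)

lemma subalgebra_generated_algebra_mono:
  assumes "I \<subseteq> I'" "J \<subseteq> J'"
  shows "subalgebra (generated_algebra M A B U V I' J') (generated_algebra M A B U V I J)"
  using assms unfolding subalgebra_def sets_generated_algebra space_generated_algebra
  by (intro conjI refl sigma_sets_mono') auto

lemma subalgebra_generated_algebraI:
  assumes "space N = space M"
    and "\<And>i. i \<in> I \<Longrightarrow> U i \<in> N \<rightarrow>\<^sub>M A" and "\<And>j. j \<in> J \<Longrightarrow> V j \<in> N \<rightarrow>\<^sub>M B"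
  shows "subalgebra N (generated_algebra M A B U V I J)"
proof -
  have "(\<Union>i\<in>I. sets (vimage_algebra (space M) (U i) A)) \<union>
      (\<Union>j\<in>J. sets (vimage_algebra (space M) (V j) B)) \<subseteq> sets N"
    by (intro Un_least UN_least sets_image_in_sets assms)
  then show ?thesis
    using sets.sigma_sets_subset[of _ N] assms(1)
    by (simp add: subalgebra_def sets_generated_algebra space_generated_algebra)
qed

lemma measurable_generated_algebra_left:
  assumes "i \<in> I" "U i \<in> M \<rightarrow>\<^sub>M A"
  shows "U i \<in> generated_algebra M A B U V I J \<rightarrow>\<^sub>M A"
proof (rule measurableI)
  fix C assume "C \<in> sets A"
  then have "U i -` C \<inter> space M \<in> sets (vimage_algebra (space M) (U i) A)"
    by (rule in_vimage_algebra)
  then show "U i -` C \<inter> space (generated_algebra M A B U V I J) \<in> sets (generated_algebra M A B U V I J)"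
    using assms(1) by (auto simp: sets_generated_algebra space_generated_algebra)
qed (use assms(2) in \<open>auto simp: space_generated_algebra dest: measurable_space\<close>)

lemma measurable_generated_algebra_right:
  assumes "j \<in> J" "V j \<in> M \<rightarrow>\<^sub>M B"
  shows "V j \<in> generated_algebra M A B U V I J \<rightarrow>\<^sub>M B"
proof (rule measurableI)
  fix C assume "C \<in> sets B"
  then have "V j -` C \<inter> space M \<in> sets (vimage_algebra (space M) (V j) B)"
    by (rule in_vimage_algebra)
  then show "V j -` C \<inter> space (generated_algebra M A B U V I J) \<in> sets (generated_algebra M A B U V I J)"
    using assms(1) by (auto simp: sets_generated_algebra space_generated_algebra)
qed (use assms(2) in \<open>auto simp: space_generated_algebra dest: measurable_space\<close>)

text \<open>The inclusion that \<open>cond_indep_mono\<close> consumes after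
  \<open>cond_indep_join\<close>, to return from a join to an algebra of the form
  \<open>generated_algebra\<close>.\<close>

lemma subalgebra_generated_algebra_Un:
  "subalgebra
     (sigma (space M)
       (sets (generated_algebra M A B U V I J) \<union> sets (generated_algebra M A B U V I' J')))
     (generated_algebra M A B U V (I \<union> I') (J \<union> J'))"
proof -
  let ?G = "generated_algebra M A B U V"
  have "sets (?G I J) \<union> sets (?G I' J') \<subseteq> Pow (space M)"
    using sets.space_closed[of "?G I J"] sets.space_closed[of "?G I' J'"]
    by (simp add: space_generated_algebra)
  moreover have "(\<Union>i\<in>I \<union> I'. sets (vimage_algebra (space M) (U i) A)) \<union>
      (\<Union>j\<in>J \<union> J'. sets (vimage_algebra (space M) (V j) B)) \<subseteq> sets (?G I J) \<union> sets (?G I' J')"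
    unfolding sets_generated_algebra by (auto intro: sigma_sets.Basic)
  ultimately show ?thesis
    unfolding subalgebra_def sets_generated_algebra[of _ _ _ _ _ "I \<union> I'"] space_generated_algebra
    by (simp add: space_measure_of_conv sigma_sets_mono')
qed

section \<open>The Markov property of the encoder process\<close>

context encoder_process
begin

abbreviation gen :: "nat set \<Rightarrow> nat set \<Rightarrow> 'w measure" where
  "gen \<equiv> generated_algebra M (restrict_space borel W) (restrict_space borel Y) Wt Yt"

text \<open>Index 0 is excluded because measurability of \<open>Wt\<close> and \<open>Yt\<close> is
  assumed only from time 1 on.\<close>

lemma subalgebra_gen: "0 \<notin> I \<Longrightarrow> 0 \<notin> J \<Longrightarrow> subalgebra M (gen I J)"
  by (rule subalgebra_generated_algebraI)
    (auto intro!: measurable_Wt measurable_Yt simp: Suc_le_eq intro: gr0I)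

text \<open>The channel is memoryless: the conditional probability of an output event given the past
  is \<open>measure (P (Wt m \<omega>)) B\<close>, a measurable function of the current state alone.
  Every event of the output's sigma-algebra is a preimage, so that sigma-algebra serves as its own
  generator.\<close>

lemma cond_indep_output:
  assumes m: "m \<ge> 1"
  shows "cond_indep (gen {} {m}) (gen {1..m} {1..<m}) (gen {m} {})"
proof (rule cond_indepI[where R = "sets (gen {} {m})"])
  show sub: "subalgebra M (gen {} {m})" "subalgebra M (gen {1..m} {1..<m})"
    using m by (auto intro!: subalgebra_gen)
  show sub': "subalgebra (gen {1..m} {1..<m}) (gen {m} {})"
    using m by (intro subalgebra_generated_algebra_mono) auto
  show "Int_stable (sets (gen {} {m}))" by (auto intro!: Int_stableI)
  show "space M \<in> sets (gen {} {m})"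
    using sets.top[of "gen {} {m}"] by (simp add: space_generated_algebra)
  show "sets (gen {} {m}) = sigma_sets (space M) (sets (gen {} {m}))"
    using sets.sigma_sets_eq[of "gen {} {m}"] by (simp add: space_generated_algebra)
  fix A assume A: "A \<in> sets (gen {} {m})"
  have "Yt m \<in> space M \<rightarrow> space (restrict_space borel Y)"
    using measurable_space[OF measurable_Yt[OF m]] by auto
  from sets_vimage_algebra2[OF this] A obtain B
    where B: "B \<in> sets (restrict_space borel Y)" "A = Yt m -` B \<inter> space M"
    by (auto simp: sets_generated_algebra_single_right)
  have "(\<lambda>w. measure (P w) B) \<in> borel_measurable (restrict_space borel W)"
    using measurable_compose[OF measurable_prob_algebraD[OF kernel_P]
        measurable_measure_subprob_algebra[OF B(1)]] .
  then have meas: "(\<lambda>\<omega>. measure (P (Wt m \<omega>)) B) \<in> borel_measurable (gen {m} {})"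
    using m by (intro measurable_compose[OF measurable_generated_algebra_left])
      (auto intro: measurable_Wt)
  have "A \<in> events" using A sub(1) by (auto simp: subalgebra_def)
  from real_cond_exp_eqI[OF sub(2) sub' integrable_indicatorI[OF this] meas]
    channel[OF m B(1)]
  show "AE \<omega> in M. real_cond_exp M (gen {1..m} {1..<m}) (indicator A) \<omega> =
      real_cond_exp M (gen {m} {}) (indicator A) \<omega>"
    unfolding B(2) by auto
qed

text \<open>The recursion determines the next state from the current state and output, but only
  almost surely. The inclusion of sigma-algebras therefore holds up to null sets, which conditioning
  on \<open>M\<close> expresses.\<close>

lemma cond_indep_state:
  assumes m: "m \<ge> 1"
  shows "cond_indep (gen {Suc m} {}) M (gen {m} {m})"
proof (rule cond_indepI[where R = "sets (gen {Suc m} {})"])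
  show sub: "subalgebra M (gen {Suc m} {})" "subalgebra M M" "subalgebra M (gen {m} {m})"
    using m by (auto intro!: subalgebra_gen simp: subalgebra_def[of M M])
  interpret K: sigma_finite_subalgebra M "gen {m} {m}" by (rule sigma_finite_subalgebraI[OF sub(3)])
  interpret MM: sigma_finite_subalgebra M M by (rule sigma_finite_subalgebraI[OF sub(2)])
  show "Int_stable (sets (gen {Suc m} {}))" by (auto intro!: Int_stableI)
  show "space M \<in> sets (gen {Suc m} {})"
    using sets.top[of "gen {Suc m} {}"] by (simp add: space_generated_algebra)
  show "sets (gen {Suc m} {}) = sigma_sets (space M) (sets (gen {Suc m} {}))"
    using sets.sigma_sets_eq[of "gen {Suc m} {}"] by (simp add: space_generated_algebra)
  fix A assume A: "A \<in> sets (gen {Suc m} {})"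
  have "Wt (Suc m) \<in> space M \<rightarrow> space (restrict_space borel W)"
    using measurable_space[OF measurable_Wt[of "Suc m"]] by auto
  from sets_vimage_algebra2[OF this] A obtain C
    where C: "C \<in> sets (restrict_space borel W)" "A = Wt (Suc m) -` C \<inter> space M"
    by (auto simp: sets_generated_algebra_single_left)
  \<comment> \<open>The event \<open>A\<close> with the next state replaced by its value under the
    recursion: it differs from \<open>A\<close> by a null set and lies in
    \<open>gen {m} {m}\<close>.\<close>
  define A' where "A' = (\<lambda>\<omega>. S (Yt m \<omega>) (Wt m \<omega>)) -` C \<inter> space M"
  have "Wt m \<in> gen {m} {m} \<rightarrow>\<^sub>M restrict_space borel W"
    "Yt m \<in> gen {m} {m} \<rightarrow>\<^sub>M restrict_space borel Y"
    using m by (auto intro!: measurable_generated_algebra_left measurable_generated_algebra_right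
        measurable_Wt measurable_Yt)
  then have "(\<lambda>\<omega>. S (Yt m \<omega>) (Wt m \<omega>)) \<in> gen {m} {m} \<rightarrow>\<^sub>M restrict_space borel W"
    using measurable_compose[OF measurable_Pair measurable_S] by simp
  from measurable_sets[OF this C(1)] have A': "A' \<in> sets (gen {m} {m})"
    by (simp add: A'_def space_generated_algebra)
  have AM: "A \<in> events" "A' \<in> events" using A A' sub by (auto simp: subalgebra_def)
  have "AE \<omega> in M. \<omega> \<in> space M" by (rule AE_space)
  with dynamics[OF m] have eq: "AE \<omega> in M. indicator A \<omega> = (indicator A' \<omega> :: real)"
    by (auto simp: C(2) A'_def indicator_def)
  have "AE \<omega> in M. real_cond_exp M (gen {m} {m}) (indicator A) \<omega> =
      real_cond_exp M (gen {m} {m}) (indicator A') \<omega>"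
    using AM by (intro K.real_cond_exp_cong eq) auto
  moreover have "AE \<omega> in M. real_cond_exp M (gen {m} {m}) (indicator A') \<omega> = indicator A' \<omega>"
    using A' by (intro K.real_cond_exp_F_meas integrable_indicatorI AM) auto
  moreover have "AE \<omega> in M. real_cond_exp M M (indicator A) \<omega> = indicator A \<omega>"
    using AM by (intro MM.real_cond_exp_F_meas integrable_indicatorI) auto
  ultimately show "AE \<omega> in M. real_cond_exp M M (indicator A) \<omega> =
      real_cond_exp M (gen {m} {m}) (indicator A) \<omega>"
    using eq by auto
qed

text \<open>Induction on the length of the block, with \<open>m\<close> general because the
  hypothesis is used at the next time: the later outputs are first conditioned on the pair of state
  and output at time \<open>m\<close>, and then the output is dropped by the channel
  property.\<close>

lemma cond_indep_outputs:
  assumes "m \<ge> 1"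
  shows "cond_indep (gen {} {m..<m + k}) (gen {1..m} {1..<m}) (gen {m} {})"
  using assms
proof (induction k arbitrary: m)
  case 0
  show ?case
    by (rule cond_indep_mono[OF cond_indep_output[OF 0]]) (auto intro!: subalgebra_generated_algebra_mono)
next
  case (Suc k)
  let ?K = "gen {m} {m}"
  \<comment> \<open>The induction hypothesis conditions on the state at time \<open>Suc m\<close>;
    by \<open>cond_indep_state\<close> this state is almost surely a function of the pair generating
    \<open>?K\<close>.\<close>
  have "cond_indep (gen {} {Suc m..<Suc m + k}) (gen {1..Suc m} {1..<Suc m}) ?K"
    using Suc.prems by (intro cond_indep_AE_enlarge[OF Suc.IH cond_indep_state])
      (auto intro!: subalgebra_generated_algebra_mono)
  \<comment> \<open>Adjoining \<open>?K\<close> brings the output at time \<open>m\<close> into the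
    block.\<close>
  from cond_indep_join[OF this]
  have 1: "cond_indep (gen {m} {m..<m + Suc k}) (gen {1..Suc m} {1..<Suc m}) ?K"
  proof (rule cond_indep_mono)
    have "{m..<m + Suc k} = {Suc m..<Suc m + k} \<union> {m}" by auto
    then show "subalgebra
        (sigma (space M) (sets (gen {} {Suc m..<Suc m + k}) \<union> sets ?K)) (gen {m} {m..<m + Suc k})"
      using subalgebra_generated_algebra_Un[of M _ _ Wt Yt "{}" "{Suc m..<Suc m + k}" "{m}" "{m}"]
      by simp
  qed
  have 2: "cond_indep ?K (gen {1..m} {1..<m}) (gen {m} {})"
    using cond_indep_mono[OF cond_indep_join[OF cond_indep_output[OF Suc.prems]]]
      subalgebra_generated_algebra_Un[of M _ _ Wt Yt "{}" "{m}" "{m}" "{}"] by simp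
  have "cond_indep (gen {m} {m..<m + Suc k}) (gen {1..m} {1..<m}) (gen {m} {})"
    by (rule cond_indep_trans[OF 1 2]) (auto intro!: subalgebra_generated_algebra_mono)
  then show ?case
    by (rule cond_indep_mono) (auto intro!: subalgebra_generated_algebra_mono)
qed

text \<open>The finite blocks starting at \<open>m\<close> increase with their length, so their
  union is stable under intersection; it generates the whole future.\<close>

lemma cond_indep_future:
  assumes m: "m \<ge> 1"
  shows "cond_indep (gen {} {m..}) (gen {1..m} {1..<m}) (gen {m} {})"
proof (rule cond_indepI[where R = "\<Union>k. sets (gen {} {m..<m + k})"])
  note fin = cond_indep_outputs[OF m]
  show "subalgebra M (gen {} {m..})" using m by (auto intro!: subalgebra_gen)
  show "subalgebra M (gen {1..m} {1..<m})" "subalgebra (gen {1..m} {1..<m}) (gen {m} {})"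
    using cond_indepD[OF fin] by auto
  show "Int_stable (\<Union>k. sets (gen {} {m..<m + k}))"
  proof (rule Int_stableI)
    fix a b assume "a \<in> (\<Union>k. sets (gen {} {m..<m + k}))" "b \<in> (\<Union>k. sets (gen {} {m..<m + k}))"
    then obtain k l where a: "a \<in> sets (gen {} {m..<m + k})" and b: "b \<in> sets (gen {} {m..<m + l})"
      by auto
    have mono: "sets (gen {} {m..<m + i}) \<subseteq> sets (gen {} {m..<m + max k l})" if "i \<le> max k l" for i
    proof -
      have "subalgebra (gen {} {m..<m + max k l}) (gen {} {m..<m + i})"
        using that by (intro subalgebra_generated_algebra_mono) auto
      then show ?thesis by (simp add: subalgebra_def)
    qed
    have "a \<in> sets (gen {} {m..<m + max k l})" "b \<in> sets (gen {} {m..<m + max k l})"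
      using a b mono[of k] mono[of l] by auto
    then show "a \<inter> b \<in> (\<Union>k. sets (gen {} {m..<m + k}))" by auto
  qed
  show "space M \<in> (\<Union>k. sets (gen {} {m..<m + k}))"
    using sets.top[of "gen {} {m..<m + 0}"] unfolding space_generated_algebra by blast
  show "sets (gen {} {m..}) = sigma_sets (space M) (\<Union>k. sets (gen {} {m..<m + k}))"
  proof (rule antisym)
    have "sets (vimage_algebra (space M) (Yt j) (restrict_space borel Y)) \<subseteq>
        (\<Union>k. sets (gen {} {m..<m + k}))" if "j \<ge> m" for j
    proof -
      \<comment> \<open>The length \<open>Suc (j - m)\<close> makes the half-open block end exactly
        with \<open>j\<close>.\<close>
      have "subalgebra (gen {} {m..<m + Suc (j - m)}) (gen {} {j})"
        using that by (intro subalgebra_generated_algebra_mono) auto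
      then have "sets (gen {} {j}) \<subseteq> (\<Union>k. sets (gen {} {m..<m + k}))"
        unfolding subalgebra_def by blast
      then show ?thesis by (simp add: sets_generated_algebra_single_right)
    qed
    then show "sets (gen {} {m..}) \<subseteq> sigma_sets (space M) (\<Union>k. sets (gen {} {m..<m + k}))"
      unfolding sets_generated_algebra[of _ _ _ _ _ _ "{m..}"] by (intro sigma_sets_mono') auto
    have "subalgebra (gen {} {m..}) (gen {} {m..<m + k})" for k
      by (intro subalgebra_generated_algebra_mono) auto
    then have "(\<Union>k. sets (gen {} {m..<m + k})) \<subseteq> sets (gen {} {m..})"
      unfolding subalgebra_def by blast
    from sets.sigma_sets_subset[OF this]
    show "sigma_sets (space M) (\<Union>k. sets (gen {} {m..<m + k})) \<subseteq> sets (gen {} {m..})"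
      by (simp add: space_generated_algebra)
  qed
  fix A assume "A \<in> (\<Union>k. sets (gen {} {m..<m + k}))"
  then obtain k where A: "A \<in> sets (gen {} {m..<m + k})" by auto
  then have "A \<in> events" using cond_indepD(1)[OF fin] by (auto simp: subalgebra_def)
  with A show "AE \<omega> in M. real_cond_exp M (gen {1..m} {1..<m}) (indicator A) \<omega> =
      real_cond_exp M (gen {m} {}) (indicator A) \<omega>"
    by (intro cond_indepD(5)[OF fin[of k]] integrable_indicatorI) auto
qed

section \<open>From reliability to invertibility\<close>

lemma invertible_if_reliable:
  assumes "reliable_encoder W Y M Wt Yt"
  shows "invertible_encoder W Y M Wt Yt"
  unfolding invertible_encoder_def
proof (intro allI impI)
  fix n :: nat assume n: "n \<ge> 1"
  \<comment> \<open>\<open>?F\<close> is the past of \<open>cond_indep_future\<close> at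
    \<open>m = n + 1\<close>; its outputs are those up to time \<open>n\<close>, so it contains
    \<open>?K\<close>.\<close>
  let ?F = "gen {1..n + 1} {1..<n + 1}" and ?K = "gen {n + 1} {1..n}"
  obtain V where V: "V \<in> gen {} {1..} \<rightarrow>\<^sub>M restrict_space borel W"
    and WV: "AE \<omega> in M. Wt 1 \<omega> = V \<omega>"
    using assms unfolding reliable_encoder_def as_measurable_def by blast
  have "cond_indep (gen {} {n + 1..}) ?F ?K"
    using n by (intro cond_indep_enlarge[OF cond_indep_future] subalgebra_generated_algebra_mono) auto
  \<comment> \<open>Joining \<open>?K\<close> supplies the outputs up to time \<open>n\<close>, so
    the statement covers the entire output sequence, from which \<open>V\<close> is
    computed.\<close>
  from cond_indep_join[OF this] have indep: "cond_indep (gen {} {1..}) ?F ?K"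
  proof (rule cond_indep_mono)
    show "subalgebra (sigma (space M) (sets (gen {} {n + 1..}) \<union> sets ?K)) (gen {} {1..})"
      by (rule subalgebra_trans[OF subalgebra_generated_algebra_Un])
        (rule subalgebra_generated_algebra_mono, auto)
  qed
  note sub = cond_indepD(1-4)[OF indep]
  interpret F: sigma_finite_subalgebra M ?F by (rule sigma_finite_subalgebraI[OF sub(2)])
  \<comment> \<open>Boundedness of \<open>W\<close> makes all coordinates integrable.\<close>
  obtain r where r: "\<And>w. w \<in> W \<Longrightarrow> norm w \<le> r"
    using bounded_W unfolding bounded_iff by auto
  have VW: "V \<omega> \<in> W" if "\<omega> \<in> space M" for \<omega>
    using measurable_space[OF V] that by (simp add: space_generated_algebra space_restrict_space)
  have WW: "Wt 1 \<omega> \<in> W" if "\<omega> \<in> space M" for \<omega>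
    using measurable_space[OF measurable_Wt[of 1]] that by (simp add: space_restrict_space)
  have V': "V \<in> borel_measurable (gen {} {1..})"
    using V by (simp add: measurable_restrict_space2_iff)
  have W': "Wt 1 \<in> borel_measurable ?F"
    using measurable_generated_algebra_left[of 1 "{1..n+1}" Wt M "restrict_space borel W"] measurable_Wt[of 1]
    by (auto simp: measurable_restrict_space2_iff)
  have WM: "Wt 1 \<in> borel_measurable M" and VM: "V \<in> borel_measurable M"
    using measurable_from_subalg[OF sub(2) W'] measurable_from_subalg[OF sub(1) V'] by auto
  \<comment> \<open>Conditional expectations are taken coordinatewise, as
    \<open>real_cond_exp\<close> acts on real functions, and reassembled into a vector.\<close>
  define g where "g \<omega> = (\<Sum>b\<in>Basis. real_cond_exp M ?K (\<lambda>\<omega>. V \<omega> \<bullet> b) \<omega> *\<^sub>R b)" for \<omega>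
  have g: "g \<in> borel_measurable ?K" unfolding g_def by measurable
  have bound: "norm (h \<omega> \<bullet> b) \<le> r" if "h \<omega> \<in> W" "b \<in> Basis" for h :: "'w \<Rightarrow> 'a" and \<omega> b
    using Basis_le_norm[OF that(2), of "h \<omega>"] r[OF that(1)] by simp
  have "AE \<omega> in M. real_cond_exp M ?K (\<lambda>\<omega>. V \<omega> \<bullet> b) \<omega> = Wt 1 \<omega> \<bullet> b" if b: "b \<in> Basis" for b
  proof -
    have iV: "integrable M (\<lambda>\<omega>. V \<omega> \<bullet> b)"
      by (rule integrable_const_bound[where B = r]) (use VM VW bound[OF _ b] in auto)
    have iW: "integrable M (\<lambda>\<omega>. Wt 1 \<omega> \<bullet> b)"
      by (rule integrable_const_bound[where B = r]) (use WM WW bound[OF _ b] in auto)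
    \<comment> \<open>\<open>V\<close> has the measurability that \<open>indep\<close> asks for,
      while \<open>Wt 1\<close> is \<open>?F\<close>-measurable; their almost sure equality lets one
      replace the other under conditioning on \<open>?F\<close>.\<close>
    have "AE \<omega> in M. real_cond_exp M ?F (\<lambda>\<omega>. V \<omega> \<bullet> b) \<omega> = real_cond_exp M ?K (\<lambda>\<omega>. V \<omega> \<bullet> b) \<omega>"
      by (rule cond_indepD(5)[OF indep _ iV]) (use V' in auto)
    moreover have "AE \<omega> in M. real_cond_exp M ?F (\<lambda>\<omega>. Wt 1 \<omega> \<bullet> b) \<omega> = real_cond_exp M ?F (\<lambda>\<omega>. V \<omega> \<bullet> b) \<omega>"
      using iV iW WV by (intro F.real_cond_exp_cong) auto
    moreover have "AE \<omega> in M. real_cond_exp M ?F (\<lambda>\<omega>. Wt 1 \<omega> \<bullet> b) \<omega> = Wt 1 \<omega> \<bullet> b"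
      by (rule F.real_cond_exp_F_meas[OF iW]) (use W' in auto)
    ultimately show ?thesis by auto
  qed
  then have "AE \<omega> in M. \<forall>b\<in>Basis. real_cond_exp M ?K (\<lambda>\<omega>. V \<omega> \<bullet> b) \<omega> = Wt 1 \<omega> \<bullet> b"
    by (intro AE_finite_allI) auto
  then have Wg: "AE \<omega> in M. Wt 1 \<omega> = g \<omega>"
    unfolding g_def by eventually_elim (simp add: euclidean_representation)
  \<comment> \<open>The version \<open>g\<close> may leave \<open>W\<close> on a null set; the
    default value \<open>w0\<close> there makes it a map into \<open>W\<close>. Such a point exists
    because a probability space is nonempty.\<close>
  obtain w0 where w0: "w0 \<in> W" using not_empty WW by blast
  define g' where "g' \<omega> = (if g \<omega> \<in> W then g \<omega> else w0)" for \<omega>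
  have [measurable]: "W \<in> sets borel" using open_W by simp
  have "g' \<in> borel_measurable ?K" unfolding g'_def using g by measurable
  then have "g' \<in> ?K \<rightarrow>\<^sub>M restrict_space borel W"
    using w0 by (intro measurable_restrict_space2) (auto simp: g'_def)
  moreover have "AE \<omega> in M. Wt 1 \<omega> = g' \<omega>"
    using Wg AE_space by eventually_elim (metis WW g'_def)
  ultimately show "as_measurable M ?K (restrict_space borel W) (Wt 1)"
    unfolding as_measurable_def by auto
qed

end

theorem lemma4p8:
  fixes W :: "'a::euclidean_space set"
    and Y :: "'b::euclidean_space set"
    and S :: "'b \<Rightarrow> 'a \<Rightarrow> 'a"
    and P :: "'a \<Rightarrow> 'b measure"
    and M :: "'w measure"
    and Wt :: "nat \<Rightarrow> 'w \<Rightarrow> 'a"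
    and Yt :: "nat \<Rightarrow> 'w \<Rightarrow> 'b"
  assumes "encoder_process W Y S P M Wt Yt"
    and "reliable_encoder W Y M Wt Yt"
  shows "invertible_encoder W Y M Wt Yt"
  by (rule encoder_process.invertible_if_reliable[OF assms])

end
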